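(* For every max-min 1-bounded space algorithm $ALG$ for the classic bin packing problem and every positive even integer $m$, there exists a sorted item sequence $I$ such that $OPT(I)=m$ and $ALG(I)\ge \frac{5}{4}\cdot OPT(I)-\frac{1}{4}$.
   Context: Classic bin packing: an item sequence $I=(a_1,\dots,a_n)\in(0,1]^n$ must be packed into bins of capacity $1$ (an assignment $f:\{1,\dots,n\}\to\mathbb{N}$ with $\sum_{i:f(i)=j}a_i\le1$ for every $j$); $OPT(I)$ is the minimum number of non-empty bins, and $ALG(I)$ is the number of non-empty bins used by algorithm $ALG$ on $I$. $I$ is sorted if $a_1\ge a_2\ge\cdots\ge a_n$. A max-min algorithm first sorts the input in non-increasing order and then repeatedly takes either the head (first, largest) or the tail (last, smallest) item of the currently remaining sorted sequence and packs it into a bin, where each decision may depend only on the items already packed and on the current head and tail items, without seeing any other remaining items. A bin is open if it already contains an item and the algorithm may still pack items into it; once closed, a bin never receives further items. A 1-bounded space algorithm keeps at most one open bin at any time, i.e. each item is packed either into the most recently opened bin or into a new bin. *)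

theory Defs
  imports Complex_Main
begin

text \<open>History of an execution: list (in packing order) of packed items, each recorded as
  (size, taken from the head?, placed into a newly opened bin?).\<close>
type_synonym history = "(real \<times> bool \<times> bool) list"

text \<open>A max-min 1-bounded space algorithm: given the history of packed items and the current
  head (largest remaining) and tail (smallest remaining) item, it decides
  (take the head?, open a new bin for the item?). If the chosen item does not fit into the
  single open bin (or no bin is open yet), a new bin is necessarily opened; the previous
  bin is then closed forever.\<close>
type_synonym maxmin_alg = "history \<Rightarrow> real \<Rightarrow> real \<Rightarrow> bool \<times> bool"

function run :: "maxmin_alg \<Rightarrow> history \<Rightarrow> real list \<Rightarrow> real \<Rightarrow> nat \<Rightarrow> nat" where
  "run A h [] load k = k"
| "run A h (x # xs) load k =
     (let d = A h x (last (x # xs));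
          th = fst d;
          y = (if th then x else last (x # xs));
          rest = (if th then xs else butlast (x # xs));
          nb = (snd d \<or> k = 0 \<or> load + y > 1)
      in run A (h @ [(y, th, nb)]) rest (if nb then y else load + y) (if nb then Suc k else k))"
  by pat_completeness auto
termination
  by (relation "measure (\<lambda>(_, _, xs, _, _). length xs)") (auto simp: Let_def)

definition alg_bins :: "maxmin_alg \<Rightarrow> real list \<Rightarrow> nat" where
  "alg_bins A I = run A [] I 0 0"

definition feasible_packing :: "real list \<Rightarrow> (nat \<Rightarrow> nat) \<Rightarrow> bool" where
  "feasible_packing I f \<longleftrightarrow> (\<forall>j. (\<Sum>i\<in>{i. i < length I \<and> f i = j}. I ! i) \<le> 1)"

definition opt :: "real list \<Rightarrow> nat" where
  "opt I = (LEAST k. \<exists>f. feasible_packing I f \<and> card (f ` {..<length I}) = k)"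

definition valid_items :: "real list \<Rightarrow> bool" where
  "valid_items I \<longleftrightarrow> (\<forall>x\<in>set I. 0 < x \<and> x \<le> 1)"

end

theory Submission
  imports Defs "HOL-Library.Multiset"
begin

text \<open>
  Let \<open>m = 2n + 2\<close>. The adversary shows heads \<open>H = 0.65\<close> and slowly growing tails
  \<open>T 1 < T 2 < \<dots>\<close> just above \<open>0.3\<close>, and completes the instance by items \<open>G\<close> near \<open>0.35\<close> such that an
  optimal packing consists of bins \<open>H + G\<close> and \<open>T + G + G\<close>. The algorithm has to use up the heads
  and tails first, in bins no better than \<open>H + T\<close> or \<open>T + T + T\<close>, and then packs the items \<open>G\<close> in
  pairs. Charging \<open>3/4\<close>, \<open>1/4\<close> and \<open>1/2\<close> for \<open>H\<close>, \<open>T\<close> and \<open>G\<close> gives the ratio \<open>5/4\<close>, except that up to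
  \<open>1/2\<close> is lost around the switch to items \<open>G\<close>.

  A single bin in the first phase other than \<open>H + T\<close> makes up for one half of this loss, which is
  enough. If all bins are of the form \<open>H + T\<close>, the adversary answers the \<open>n\<close>-th head by a different
  ending: two optimal bins \<open>0.36 + 0.32 + 0.32\<close> and \<open>T + g + g\<close> besides the items \<open>G > g\<close>, of which
  the algorithm can put three items together only once.
\<close>

section \<open>Packings\<close>

text \<open>Labels are attached to items rather than to positions, so that they survive a reordering
  of the list.\<close>

lemma labelling_of_bins:
  fixes bs :: "real list list"
  assumes "\<forall>b\<in>set bs. sum_list b \<le> 1"
  shows "\<exists>ps. map fst ps = concat bs \<and> snd ` set ps \<subseteq> {..<length bs} \<and>
              (\<forall>j. sum_list (map fst (filter (\<lambda>p. snd p = j) ps)) \<le> 1)"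
  using assms
proof (induction bs rule: rev_induct)
  case Nil
  show ?case by (intro exI[of _ "[]"]) simp
next
  case (snoc b bs)
  then obtain ps where ps: "map fst ps = concat bs" "snd ` set ps \<subseteq> {..<length bs}"
    "\<forall>j. sum_list (map fst (filter (\<lambda>p. snd p = j) ps)) \<le> 1" by auto
  let ?qs = "map (\<lambda>x. (x, length bs)) b"
  have old: "filter (\<lambda>p. snd p = length bs) ps = []"
    using ps(2) by (auto simp: filter_empty_conv)
  have new: "map fst (filter (\<lambda>p. snd p = j) ?qs) = (if j = length bs then b else [])" for j
    by (induction b) auto
  have "sum_list (map fst (filter (\<lambda>p. snd p = j) (ps @ ?qs))) \<le> 1" for j
    using ps(3) snoc.prems by (cases "j = length bs") (simp_all only: filter_append map_append sum_list_append old new, auto)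
  moreover have "map fst (ps @ ?qs) = concat (bs @ [b])"
    using ps(1) by (simp add: comp_def)
  moreover have "snd ` set (ps @ ?qs) \<subseteq> {..<length (bs @ [b])}"
    using ps(2) by auto
  ultimately show ?case by blast
qed

lemma feasible_packing_of_bins:
  assumes eq: "mset I = mset (concat bs)" and le: "\<forall>b\<in>set bs. sum_list b \<le> 1"
  shows "\<exists>f. feasible_packing I f \<and> card (f ` {..<length I}) \<le> length bs"
proof -
  obtain ps where ps: "map fst ps = concat bs" "snd ` set ps \<subseteq> {..<length bs}"
    "\<forall>j. sum_list (map fst (filter (\<lambda>p. snd p = j) ps)) \<le> 1"
    using labelling_of_bins[OF le] by blast
  \<comment> \<open>The labels are carried along the permutation between \<open>concat bs\<close>
    and \<open>I\<close>.\<close>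
  obtain ls where ls: "length ls = length I" "mset (zip I ls) = mset (zip (map fst ps) (map snd ps))"
    using ex_mset_zip_left[of "map fst ps" "map snd ps" I] eq unfolding ps(1)[symmetric] by auto
  define qs where "qs = zip I ls"
  have perm: "mset qs = mset ps" using ls(2) by (simp add: qs_def zip_map_fst_snd)
  have len: "length qs = length I" by (simp add: qs_def ls(1))
  have nth: "fst (qs ! i) = I ! i" if "i < length I" for i
    using that ls(1) by (simp add: qs_def)
  define f where "f i = snd (qs ! i)" for i
  have "feasible_packing I f"
    unfolding feasible_packing_def
  proof
    fix j
    have "(\<Sum>i\<in>{i. i < length I \<and> f i = j}. I ! i)
        = (\<Sum>i<length I. if f i = j then I ! i else 0)"
      by (subst sum.inter_filter[symmetric]) (auto intro!: sum.cong)
    also have "\<dots> = (\<Sum>i<length qs. (map (\<lambda>p. if snd p = j then fst p else 0) qs) ! i)"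
      using len nth by (intro sum.cong) (auto simp: f_def)
    also have "\<dots> = sum_list (map (\<lambda>p. if snd p = j then fst p else 0) qs)"
      by (simp add: sum_list_sum_nth atLeast0LessThan)
    also have "\<dots> = sum_list (map fst (filter (\<lambda>p. snd p = j) qs))"
      by (simp add: sum_list_map_filter')
    also have "\<dots> = sum_mset (image_mset fst (filter_mset (\<lambda>p. snd p = j) (mset qs)))"
      by (simp flip: mset_filter mset_map sum_mset_sum_list)
    also have "\<dots> = sum_list (map fst (filter (\<lambda>p. snd p = j) ps))"
      unfolding perm by (simp flip: mset_filter mset_map sum_mset_sum_list)
    finally show "(\<Sum>i\<in>{i. i < length I \<and> f i = j}. I ! i) \<le> 1" using ps(3) by simp
  qed
  moreover have "f ` {..<length I} \<subseteq> {..<length bs}"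
  proof -
    have "set qs = set ps" using perm by (metis set_mset_mset)
    then show ?thesis using ps(2) len nth_mem[of _ qs] by (force simp: f_def)
  qed
  then have "card (f ` {..<length I}) \<le> length bs"
    by (metis card_lessThan card_mono finite_lessThan)
  ultimately show ?thesis by blast
qed

lemma sum_list_le_bins:
  assumes "feasible_packing I f"
  shows "sum_list I \<le> real (card (f ` {..<length I}))"
proof -
  have "sum_list I = (\<Sum>i<length I. I ! i)"
    by (simp add: sum_list_sum_nth atLeast0LessThan)
  also have "\<dots> = (\<Sum>j\<in>f ` {..<length I}. \<Sum>i\<in>{i. i \<in> {..<length I} \<and> f i = j}. I ! i)"
    by (rule sum.image_gen) simp
  also have "\<dots> \<le> (\<Sum>j\<in>f ` {..<length I}. 1)"
    using assms by (intro sum_mono) (simp add: feasible_packing_def)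
  finally show ?thesis by simp
qed

text \<open>The total size bounds the number of bins from below; as this number is an integer, a
  total above \<open>length bs - 1\<close> suffices.\<close>

lemma opt_eqI:
  assumes "mset I = mset (concat bs)" "\<forall>b\<in>set bs. sum_list b \<le> 1"
    and "real (length bs) - 1 < sum_list I"
  shows "opt I = length bs"
proof -
  let ?P = "\<lambda>k. \<exists>f. feasible_packing I f \<and> card (f ` {..<length I}) = k"
  obtain f where f: "feasible_packing I f" "card (f ` {..<length I}) \<le> length bs"
    using feasible_packing_of_bins assms by blast
  have "opt I \<le> card (f ` {..<length I})"
    unfolding opt_def by (rule Least_le) (use f in blast)
  then have "opt I \<le> length bs" using f(2) by simp
  moreover have "?P (opt I)"
    unfolding opt_def by (rule LeastI_ex) (use f in blast)
  then have "sum_list I \<le> real (opt I)"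
    using sum_list_le_bins[of I] by metis
  ultimately show ?thesis using assms(3) by linarith
qed

section \<open>Lower bounds for the remaining run\<close>

text \<open>Unfolding would loop on \<open>butlast (x # xs)\<close>.\<close>
declare run.simps(2) [simp del]

lemma run_head:
  assumes "xs \<noteq> []" "fst (A h (hd xs) (last xs))"
    and "nb \<longleftrightarrow> snd (A h (hd xs) (last xs)) \<or> k = 0 \<or> 1 < load + hd xs"
  shows "run A h xs load k = run A (h @ [(hd xs, True, nb)]) (tl xs)
           (if nb then hd xs else load + hd xs) (if nb then Suc k else k)"
proof -
  obtain x ys where "xs = x # ys" using assms(1) by (cases xs) auto
  then show ?thesis using assms by (simp only: run.simps(2) Let_def if_True list.sel simp_thms)
qed

lemma run_tail:
  assumes "xs \<noteq> []" "\<not> fst (A h (hd xs) (last xs))"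
    and "nb \<longleftrightarrow> snd (A h (hd xs) (last xs)) \<or> k = 0 \<or> 1 < load + last xs"
  shows "run A h xs load k = run A (h @ [(last xs, False, nb)]) (butlast xs)
           (if nb then last xs else load + last xs) (if nb then Suc k else k)"
proof -
  obtain x ys where "xs = x # ys" using assms(1) by (cases xs) auto
  then show ?thesis using assms by (simp only: run.simps(2) Let_def if_False list.sel simp_thms)
qed

text \<open>A new bin is always allowed, so only the joining cases carry information. The history
  stays abstract because \<open>lb\<close> quantifies over it.\<close>

lemma run_cases:
  assumes "xs \<noteq> []"
  obtains (head_join) h' where "0 < k" "load + hd xs \<le> 1"
      "run A h xs load k = run A h' (tl xs) (load + hd xs) k"
  | (head_new) h' where "run A h xs load k = run A h' (tl xs) (hd xs) (Suc k)"
  | (tail_join) h' where "0 < k" "load + last xs \<le> 1"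
      "run A h xs load k = run A h' (butlast xs) (load + last xs) k"
  | (tail_new) h' where "run A h xs load k = run A h' (butlast xs) (last xs) (Suc k)"
proof (cases "fst (A h (hd xs) (last xs))")
  case True
  define nb where "nb \<longleftrightarrow> snd (A h (hd xs) (last xs)) \<or> k = 0 \<or> 1 < load + hd xs"
  show thesis using run_head[of xs A h nb k load] assms True nb_def
    by (cases nb) (auto intro: head_join head_new)
next
  case False
  define nb where "nb \<longleftrightarrow> snd (A h (hd xs) (last xs)) \<or> k = 0 \<or> 1 < load + last xs"
  show thesis using run_tail[of xs A h nb k load] assms False nb_def
    by (cases nb) (auto intro: tail_join tail_new)
qed

text \<open>Bins are counted in halves, so that a bin holding two items pays exactly for them.\<close>

definition lb :: "real list \<Rightarrow> real \<Rightarrow> nat \<Rightarrow> bool" where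
  "lb xs load N \<longleftrightarrow> (\<forall>A h k. 0 < k \<longrightarrow> 2 * k + N \<le> 2 * run A h xs load k)"

lemma lbD: "lb xs load N \<Longrightarrow> 0 < k \<Longrightarrow> 2 * k + N \<le> 2 * run A h xs load k"
  by (simp add: lb_def)

lemma lb_mono: "lb xs load N \<Longrightarrow> N' \<le> N \<Longrightarrow> lb xs load N'"
  unfolding lb_def by (meson add_left_mono order_trans)

lemma run_ge: "k \<le> run A h xs load k"
proof (induction "length xs" arbitrary: h xs load k rule: less_induct)
  case less
  show ?case
  proof (cases "xs = []")
    case False
    have "length (tl xs) < length xs" "length (butlast xs) < length xs" using False by auto
    note IH = this[THEN less]
    show ?thesis
      by (rule run_cases[OF False, of k load A h]) (metis IH Suc_leD)+
  qed simp
qed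

lemma lb_0: "lb xs load 0"
  using run_ge by (simp add: lb_def)

lemma lbI:
  assumes "xs \<noteq> []"
    and "load + hd xs \<le> 1 \<Longrightarrow> lb (tl xs) (load + hd xs) N"
    and "lb (tl xs) (hd xs) (N - 2)"
    and "load + last xs \<le> 1 \<Longrightarrow> lb (butlast xs) (load + last xs) N"
    and "lb (butlast xs) (last xs) (N - 2)"
  shows "lb xs load N"
  unfolding lb_def
proof (intro allI impI)
  fix A h and k :: nat
  assume k: "0 < k"
  show "2 * k + N \<le> 2 * run A h xs load k"
  proof (rule run_cases[OF assms(1), of k load A h], goal_cases head_join head_new tail_join tail_new)
    case (head_join h')
    then show ?thesis using lbD[OF assms(2)] k by simp
  next
    case (head_new h')
    then show ?thesis using lbD[OF assms(3), of "Suc k" A h'] by simp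
  next
    case (tail_join h')
    then show ?thesis using lbD[OF assms(4)] k by simp
  next
    case (tail_new h')
    then show ?thesis using lbD[OF assms(5), of "Suc k" A h'] by simp
  qed
qed

text \<open>Here the algorithm is fixed and known to open a bin, so the joining moves of
  \<open>lbI\<close> disappear and both halves are gained.\<close>

lemma run_new_first:
  assumes "xs \<noteq> []"
    and "snd (A h (hd xs) (last xs)) \<or> k = 0 \<or>
         load + (if fst (A h (hd xs) (last xs)) then hd xs else last xs) > 1"
    and "lb (tl xs) (hd xs) N" and "lb (butlast xs) (last xs) N"
  shows "2 * k + N + 2 \<le> 2 * run A h xs load k"
proof (cases "fst (A h (hd xs) (last xs))")
  case True
  then have "run A h xs load k = run A (h @ [(hd xs, True, True)]) (tl xs) (hd xs) (Suc k)"
    using assms(1,2) by (subst run_head[where nb = True]) auto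
  then show ?thesis using lbD[OF assms(3), of "Suc k"] by simp
next
  case False
  then have "run A h xs load k = run A (h @ [(last xs, False, True)]) (butlast xs) (last xs) (Suc k)"
    using assms(1,2) by (subst run_tail[where nb = True]) auto
  then show ?thesis using lbD[OF assms(4), of "Suc k"] by simp
qed

text \<open>Joining keeps the total unchanged, so the open bin can never absorb everything and one
  more bin is needed.\<close>

lemma lb_volume: "1 < load + sum_list xs \<Longrightarrow> load \<le> 1 \<Longrightarrow> lb xs load 2"
proof (induction "length xs" arbitrary: xs load rule: less_induct)
  case less
  then have ne: "xs \<noteq> []" by auto
  have "sum_list xs = hd xs + sum_list (tl xs)" using ne by (cases xs) auto
  moreover have "sum_list xs = sum_list (butlast xs) + last xs"
    using ne by (cases xs rule: rev_cases) auto
  ultimately have "load + hd xs + sum_list (tl xs) > 1" "load + last xs + sum_list (butlast xs) > 1"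
    using less.prems(1) by simp_all
  then have "load + hd xs \<le> 1 \<Longrightarrow> lb (tl xs) (load + hd xs) 2"
    and "load + last xs \<le> 1 \<Longrightarrow> lb (butlast xs) (load + last xs) 2"
    using ne by (auto intro: less.hyps)
  then show ?case
    using ne by (intro lbI[of xs]) (simp_all add: lb_0)
qed

section \<open>How many items of a multiset the open bin can still take\<close>

definition at_most :: "nat \<Rightarrow> real \<Rightarrow> real multiset \<Rightarrow> bool" where
  "at_most c load W \<longleftrightarrow> (\<forall>S. S \<subseteq># W \<longrightarrow> size S = Suc c \<longrightarrow> 1 < load + sum_mset S)"

lemma subseteq_add_mset_cases:
  assumes "W \<subseteq># add_mset y Z"
  obtains "W \<subseteq># Z" | W' where "W = add_mset y W'" "W' \<subseteq># Z"
proof (cases "y \<in># W")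
  case True
  then obtain W' where "W = add_mset y W'" by (metis mset_add)
  then show thesis using that(2) assms by simp
next
  case False
  have "W \<subseteq># Z"
  proof (rule mset_subset_eqI)
    fix a
    show "count W a \<le> count Z a"
      using mset_subset_eq_count[OF assms, of a] False by (cases "a = y") (auto simp: not_in_iff)
  qed
  then show thesis by (rule that(1))
qed

lemma at_most_subset: "at_most c load W \<Longrightarrow> W' \<subseteq># W \<Longrightarrow> at_most c load W'"
  unfolding at_most_def using subset_mset.order_trans by blast

lemma at_most_mono: "at_most c load W \<Longrightarrow> load \<le> load' \<Longrightarrow> at_most c load' W"
  unfolding at_most_def by force

lemma at_most_remove: "at_most (Suc c) load (add_mset y W) \<Longrightarrow> at_most c (load + y) W"
  unfolding at_most_def
proof (intro allI impI)
  fix S assume *: "\<forall>S. S \<subseteq># add_mset y W \<longrightarrow> size S = Suc (Suc c) \<longrightarrow> 1 < load + sum_mset S"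
    and "S \<subseteq># W" "size S = Suc c"
  then have "1 < load + sum_mset (add_mset y S)"
    by (metis mset_subset_eq_add_mset_cancel size_add_mset)
  then show "1 < load + y + sum_mset S" by (simp add: add.assoc)
qed

lemma at_most_0_add: "at_most 0 load (add_mset y W) \<Longrightarrow> 1 < load + y"
  unfolding at_most_def by (drule spec[of _ "{#y#}"]) simp

lemma at_most_ge:
  assumes "\<And>x. x \<in># W \<Longrightarrow> g \<le> x" "1 < load + real (Suc c) * g"
  shows "at_most c load W"
  unfolding at_most_def
proof (intro allI impI)
  fix S assume S: "S \<subseteq># W" "size S = Suc c"
  have "real (size S) * g \<le> sum_mset S"
    using S(1) assms(1)
  proof (induction S)
    case (add x S)
    then have "real (size S) * g \<le> sum_mset S" "g \<le> x"
      by (auto dest: mset_subset_eq_insertD simp: subset_mset.less_imp_le)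
    then show ?case by (simp add: algebra_simps)
  qed simp
  then show "1 < load + sum_mset S" using assms(2) S(2) by simp
qed

text \<open>A selection either avoids \<open>y\<close> or spends one place on it. This admits an
  exceptional item such as \<open>Y\<close>, which lies below the bound \<open>g\<close> of the
  others.\<close>

lemma at_most_add:
  assumes "at_most (Suc c) load W" "at_most c (load + y) W"
  shows "at_most (Suc c) load (add_mset y W)"
  unfolding at_most_def
proof (intro allI impI)
  fix S assume S: "S \<subseteq># add_mset y W" "size S = Suc (Suc c)"
  from S(1) show "1 < load + sum_mset S"
    by (cases rule: subseteq_add_mset_cases) (use S(2) assms in \<open>auto simp: at_most_def add.assoc\<close>)
qed

text \<open>The items outside \<open>W\<close> are free: the bound only counts the items of \<open>W\<close>, of which no bin
  can hold three.\<close>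

lemma lb_weight:
  assumes "W \<subseteq># mset xs" "\<forall>x\<in>set xs. 0 \<le> x" "at_most 2 0 W" "at_most c load W" "c \<le> 2"
  shows "lb xs load (size W - c)"
  using assms
proof (induction "length xs" arbitrary: xs load W c rule: less_induct)
  case less
  show ?case
  proof (cases "xs = []")
    case True
    then show ?thesis using less.prems by (simp add: lb_0)
  next
    case ne: False
    have step: "(load + y \<le> 1 \<longrightarrow> lb zs (load + y) (size W - c)) \<and> lb zs y (size W - c - 2)"
      if zs: "mset xs = add_mset y (mset zs)" "length zs < length xs" for y zs
    proof -
      have pos: "\<forall>x\<in>set zs. 0 \<le> x" "0 \<le> y"
        using less.prems(2) mset_eq_setD[of xs "y # zs"] zs(1) by auto
      have "W \<subseteq># add_mset y (mset zs)" using less.prems(1) zs(1) by simp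
      then show ?thesis
      proof (cases rule: subseteq_add_mset_cases)
        \<comment> \<open>No counted item is used up; \<open>y\<close> merely raises the
          load.\<close>
        case 1
        have "lb zs (load + y) (size W - c)"
          using less.prems 1 pos zs(2) by (intro less.hyps) (auto elim: at_most_mono)
        moreover have "lb zs y (size W - 2)"
          using less.prems 1 pos zs(2) by (intro less.hyps) (auto elim: at_most_mono)
        ultimately show ?thesis by (auto elim: lb_mono)
      next
        case (2 W')
        have nt: "at_most 2 0 W'" 
          using at_most_subset[OF less.prems(3), of W'] 2(1) mset_subset_eq_add_right[of W' "{#y#}"] by simp
        have join: "lb zs (load + y) (size W - c)" if "load + y \<le> 1"
        proof (cases c)
          case 0
          then show ?thesis using at_most_0_add less.prems(4) 2(1) that by fastforce
        next
          case (Suc c')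
          then have "at_most c' (load + y) W'" using at_most_remove less.prems(4) 2(1) by blast
          then have "lb zs (load + y) (size W' - c')"
            using nt 2 pos zs(2) less.prems(5) Suc by (intro less.hyps) auto
          then show ?thesis using 2(1) Suc by simp
        qed
        \<comment> \<open>The two halves of the bin opened by \<open>y\<close> pay for
          \<open>y\<close> and for the single counted item that can join it.\<close>
        have "at_most 1 y W'" using at_most_remove[of 1 0 y W'] less.prems(3) 2(1)
          by (simp add: numeral_2_eq_2)
        then have "lb zs y (size W' - 1)"
          using nt 2 pos zs(2) by (intro less.hyps) auto
        then have "lb zs y (size W - c - 2)" using 2(1) by (elim lb_mono) simp
        then show ?thesis using join by blast
      qed
    qed
    have "mset xs = add_mset (hd xs) (mset (tl xs))" using ne by (cases xs) auto
    moreover have "mset xs = add_mset (last xs) (mset (butlast xs))"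
      using ne by (metis append_butlast_last_id mset_append mset.simps add_mset_add_single)
    ultimately show ?thesis
      using step[of "hd xs" "tl xs"] step[of "last xs" "butlast xs"] ne
      by (intro lbI[of xs]) auto
  qed
qed

section \<open>The endgame\<close>

text \<open>A bin with three items contains \<open>T\<close> or two items \<open>Y\<close>. Since \<open>T\<close> is taken before the
  items \<open>Y\<close>, two such bins would have to be \<open>T + g + g\<close> and \<open>Y + Y + v\<close>; but as only two items
  are as small as \<open>g\<close>, the former bin leaves nothing for \<open>v\<close>.\<close>

context
  fixes T Y g :: real
  assumes T: "3 / 10 \<le> T" "T \<le> 31 / 100" and Y: "Y = 32 / 100" and g: "g = (1 - T) / 2"
begin

lemma bounds:
  "3 / 10 \<le> T" "T \<le> 31 / 100" "32 / 100 \<le> Y" "Y \<le> 32 / 100"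
  "345 / 1000 \<le> g" "g \<le> 35 / 100" "1 \<le> T + 2 * g"
  using T Y g by simp_all

text \<open>Only one \<open>Y\<close> is counted, since \<open>Y + Y + v\<close> may fit into a bin
  whereas \<open>Y + g + g\<close> does not; a second \<open>Y\<close> is a free item of
  \<open>lb_weight\<close>.\<close>

lemma lb_two_Y:
  assumes "\<forall>x\<in>set vs. g \<le> x" "zs = vs @ [Y] \<or> zs = vs @ [Y, Y]"
    and "1 < load + Y + real c * g" "c \<le> 2"
  shows "lb zs load (Suc (length vs) - c)"
proof -
  let ?W = "add_mset Y (mset vs)"
  have ge: "x \<in># mset vs \<Longrightarrow> g \<le> x" for x using assms(1) by simp
  have "at_most (Suc 1) 0 ?W"
    using bounds ge by (intro at_most_add at_most_ge[where g = g]) simp_all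
  moreover have "at_most c load ?W"
  proof (cases c)
    case 0
    then show ?thesis using assms(1,3) bounds by (intro at_most_ge[where g = Y]) force+
  next
    case (Suc c')
    then have "1 < load + real (Suc (Suc c')) * g" "1 < load + Y + real (Suc c') * g"
      using assms(3) bounds by (simp_all add: algebra_simps)
    then show ?thesis
      unfolding Suc using ge by (intro at_most_add at_most_ge[where g = g]) auto
  qed
  moreover have "?W \<subseteq># mset zs" using assms(2) by auto
  moreover have "\<forall>x\<in>set zs. 0 \<le> x" using assms(1,2) bounds by force
  ultimately have "lb zs load (size ?W - c)"
    using assms(4) by (intro lb_weight) (simp_all add: numeral_2_eq_2)
  then show ?thesis by simp
qed

text \<open>The open bin holds \<open>T\<close> and one more item. If \<open>Y\<close> joins, the
  bin is full; if an item of \<open>vs\<close> joins, it was the only one, and the remaining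
  \<open>[Y, Y]\<close> overflows the bin.\<close>

lemma lb_T_with_one:
  assumes "\<forall>x\<in>set vs. g \<le> x" "6 / 10 \<le> load"
    and "vs \<noteq> [] \<longrightarrow> 1 < load + hd vs \<or> length vs = 1"
  shows "lb (vs @ [Y, Y]) load (length vs + 1)"
proof (rule lbI, goal_cases)
  case 2
  show ?case
  proof (cases vs)
    case Nil
    then show ?thesis using lb_two_Y[of "[]" "[Y]" "load + Y" 0] assms(2) bounds by simp
  next
    case (Cons w vs')
    then show ?thesis
      using 2 assms bounds lb_volume[of "load + w" "[Y, Y]"] by (auto simp: numeral_2_eq_2)
  qed
next
  case 3
  show ?case
  proof (cases vs)
    case (Cons w vs')
    then show ?thesis
      using lb_two_Y[of vs' "vs' @ [Y, Y]" w 1] assms(1) bounds by auto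
  qed (simp add: lb_0)
next
  case 4
  then show ?case using lb_two_Y[of vs "vs @ [Y]" "load + Y" 0] assms(1,2) bounds
    by (simp add: butlast_append)
next
  case 5
  then show ?case using lb_two_Y[of vs "vs @ [Y]" Y 2] assms(1) bounds
    by (simp add: butlast_append)
qed simp

lemma lb_T_alone:
  assumes "\<forall>x\<in>set vs. g \<le> x" "vs \<noteq> []"
    and "tl vs \<noteq> [] \<longrightarrow> 1 < T + hd vs + hd (tl vs) \<or> length (tl vs) = 1"
  shows "lb (vs @ [Y, Y]) T (length vs)"
proof -
  obtain w vs' where vs: "vs = w # vs'" using assms(2) by (cases vs) auto
  have w: "g \<le> w" "\<forall>x\<in>set vs'. g \<le> x" using assms(1) vs by auto
  show ?thesis
  proof (rule lbI, goal_cases)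
    case 2
    then show ?case using lb_T_with_one[of vs' "T + w"] assms(3) vs w bounds by auto
  next
    case 3
    then show ?case using lb_two_Y[of vs' "vs' @ [Y, Y]" w 1] vs w bounds
      by (auto intro: lb_mono)
  next
    case 4
    then show ?case using lb_two_Y[of vs "vs @ [Y]" "T + Y" 1] assms(1) bounds
      by (simp add: butlast_append)
  next
    case 5
    have "lb (vs @ [Y]) Y (Suc (length vs) - 2)"
      using lb_two_Y[of vs "vs @ [Y]" Y 2] assms(1) bounds by simp
    then show ?case by (auto simp: butlast_append intro: lb_mono)
  qed simp
qed

text \<open>As \<open>T + g + g\<close> is exactly \<open>1\<close> and \<open>u\<close> is larger
  than \<open>g\<close>, the first two heads cannot both join \<open>T\<close>.\<close>

lemma lb_T_first:
  assumes "\<forall>x\<in>set (u # us). g < x"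
  shows "lb (u # us @ [g, g, Y, Y]) T (length us + 3)"
proof -
  have "lb ((u # us @ [g, g]) @ [Y, Y]) T (length (u # us @ [g, g]))"
  proof (rule lb_T_alone)
    show "\<forall>x\<in>set (u # us @ [g, g]). g \<le> x" using assms by auto
    show "tl (u # us @ [g, g]) \<noteq> [] \<longrightarrow> 1 < T + hd (u # us @ [g, g]) + hd (tl (u # us @ [g, g])) \<or>
      length (tl (u # us @ [g, g])) = 1"
      using assms bounds by (cases us) auto
  qed simp
  from lb_mono[OF this] show ?thesis by simp
qed

text \<open>The two claims need each other: a head joining \<open>v\<close> leads to the second, a
  head opening a bin leads back to the first.\<close>

lemma lb_T_remaining:
  assumes "\<forall>u\<in>set us. g < u \<and> u \<le> 1"
  shows "(\<forall>v. g < v \<longrightarrow> v \<le> 1 \<longrightarrow> lb (us @ [g, g, Y, Y, T]) v (length us + 3)) \<and>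
         (\<forall>load. 1 < load + T \<longrightarrow> lb (us @ [g, g, Y, Y, T]) load (length us + 4))"
  using assms
proof (induction us)
  case Nil
  have two: "lb [g, g, Y, Y] T 2" using lb_T_alone[of "[g, g]"] by (simp add: numeral_2_eq_2)
  have four: "lb [g, Y, Y, T] v 2" if "g \<le> v" "v \<le> 1" for v
    using that bounds by (intro lb_volume) auto
  have full: "lb [g, Y, Y, T] load 3" if "1 < load + T" for load
  proof (rule lbI, goal_cases)
    case 3
    have "lb [Y, Y, T] g 2" using bounds by (intro lb_volume) auto
    then show ?case by (auto intro: lb_mono)
  next
    case 5
    have "lb [g, Y, Y] T 2" using bounds by (intro lb_volume) auto
    then show ?case by (auto intro: lb_mono)
  qed (use that bounds in auto)
  have "lb [g, g, Y, Y, T] v 3" if "g < v" "v \<le> 1" for v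
  proof (rule lbI, goal_cases)
    case 2
    then show ?case using full[of "v + g"] that bounds by auto
  next
    case 3
    then show ?case using four[of g] bounds by (auto intro: lb_mono)
  next
    case 4
    then show ?case using lb_T_with_one[of "[g, g]" "v + T"] that bounds by (auto intro: lb_mono)
  next
    case 5
    then show ?case using two by (auto intro: lb_mono)
  qed simp
  moreover have "lb [g, g, Y, Y, T] load 4" if "1 < load + T" for load
  proof (rule lbI, goal_cases)
    case 3
    then show ?case using four[of g] bounds by auto
  next
    case 5
    then show ?case using two by auto
  qed (use that bounds in auto)
  ultimately show ?case by simp
next
  case (Cons u us)
  let ?L = "us @ [g, g, Y, Y, T]"
  have u: "g < u" "u \<le> 1" "\<forall>x\<in>set us. g < x" "\<forall>x\<in>set us. g \<le> x" using Cons.prems by auto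
  have last: "lb (u # us @ [g, g, Y, Y]) T (length us + 3)"
    using u by (intro lb_T_first) auto
  have "lb (u # ?L) v (length us + 4)" if "g < v" "v \<le> 1" for v
  proof (rule lbI, goal_cases)
    \<comment> \<open>Two items above \<open>g\<close> leave no room for \<open>T\<close>, so the
      second claim of the induction hypothesis applies.\<close>
    case 2
    then show ?case using Cons that u bounds by auto
  next
    case 3
    then show ?case using Cons u by (auto intro: lb_mono)
  next
    case 4
    then show ?case using lb_T_with_one[of "u # us @ [g, g]" "v + T"] that u bounds
      by (auto simp: butlast_append intro: lb_mono)
  next
    case 5
    then show ?case using last by (auto simp: butlast_append intro: lb_mono)
  qed simp
  moreover have "lb (u # ?L) load (length us + 5)" if "1 < load + T" for load
  proof (rule lbI, goal_cases)
    case 3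
    then show ?case using Cons u by (auto intro: lb_mono)
  next
    case 5
    then show ?case using last by (auto simp: butlast_append intro: lb_mono)
  qed (use that u bounds in auto)
  ultimately show ?case by (simp add: ac_simps)
qed

lemma endgame_run:
  assumes "\<forall>x\<in>set (u # us). g < x \<and> x \<le> 1" and xs: "xs = u # us @ [g, g, Y, Y, T]"
    and "snd (A h u T) \<or> k = 0 \<or> load + (if fst (A h u T) then u else T) > 1"
  shows "2 * k + length us + 5 \<le> 2 * run A h xs load k"
proof -
  have "lb (us @ [g, g, Y, Y, T]) u (length us + 3)"
    using lb_T_remaining[of us] assms(1) by auto
  moreover have "lb (u # us @ [g, g, Y, Y]) T (length us + 3)"
    using assms(1) by (intro lb_T_first) auto
  ultimately show ?thesis
    using run_new_first[of xs A h k load "length us + 3"] assms(3)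
    by (auto simp: xs butlast_append split: if_splits)
qed

end

section \<open>The instances\<close>

lemma replicate_mset_plus: "replicate_mset (a + b) x = replicate_mset a x + replicate_mset b x"
  by (induction a) auto

lemma mset_concat_replicate_pair:
  "mset (concat (replicate h [x, y])) = replicate_mset h x + replicate_mset h y"
  by (induction h) auto

lemma mset_concat_map_triple:
  "mset (concat (map (\<lambda>i. [f i, y, y]) is)) = mset (map f is) + replicate_mset (2 * length is) y"
  by (induction "is") auto

lemma sum_list_concat_ge:
  fixes bs :: "real list list"
  assumes "\<And>b. b \<in> set bs \<Longrightarrow> c \<le> sum_list b"
  shows "real (length bs) * c \<le> sum_list (concat bs)"
  using assms
proof (induction bs)
  case (Cons b bs)
  then have "c \<le> sum_list b" "real (length bs) * c \<le> sum_list (concat bs)" by auto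
  then show ?case by (simp add: algebra_simps)
qed simp

text \<open>The adversary shows the head \<open>H\<close> and the tails \<open>T 1 < T 2 < \<dots>\<close> for as long as possible;
  \<open>m = 2 * n + 2\<close>.\<close>

locale maxmin_adversary =
  fixes A :: maxmin_alg and n :: nat and T :: "nat \<Rightarrow> real"
  assumes T_ge: "3 / 10 \<le> T j" and T_lt: "T j < 3 / 10 + 1 / (100 * real (2 * n + 2))"
    and T_mono: "strict_mono T"
begin

declare upt_Suc [simp del]

definition H :: real where "H = 65 / 100"
text \<open>The largest size of which two fit beside \<open>T t\<close>, hence beside every earlier
  tail; being at most \<open>0.35\<close>, one also fits beside \<open>H\<close>.\<close>

definition G :: "nat \<Rightarrow> real" where "G t = (1 - T t) / 2"
definition tails :: "nat \<Rightarrow> real list" where "tails t = rev (map T [1..<Suc t])"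

definition instB :: "nat \<Rightarrow> nat \<Rightarrow> real list" where
  "instB h t = replicate h H @ replicate (h + 2 * t) (G t) @ tails t"

text \<open>The item \<open>36 / 100\<close> does not fit beside \<open>H\<close>. The number
  \<open>3 * n\<close> serves both \<open>t = n\<close> and \<open>t = n - 1\<close>.\<close>

definition endgame :: "nat \<Rightarrow> real list" where
  "endgame t = 36 / 100 # replicate (3 * n) (G t) @
     [G (Suc t), G (Suc t), 32 / 100, 32 / 100, T (Suc t)]"

definition instA :: "nat \<Rightarrow> real list" where
  "instA t = replicate n H @ endgame t @ tails t"

definition wins :: "real list \<Rightarrow> bool" where
  "wins I \<longleftrightarrow> valid_items I \<and> sorted_wrt (\<ge>) I \<and> opt I = 2 * n + 2 \<and>
     5 * (2 * n + 2) \<le> 4 * alg_bins A I + 1"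

lemma T_le: "T j \<le> 305 / 1000"
proof -
  have "1 / (100 * real (2 * n + 2)) \<le> 1 / 200" by (intro divide_left_mono) auto
  then show ?thesis using T_lt[of j] by linarith
qed

lemma T_less: "T t < T (Suc t)"
  using T_mono by (simp add: strict_mono_Suc_iff)

lemma G_bounds: "345 / 1000 \<le> G t" "G t \<le> 35 / 100"
  using T_ge[of t] T_le[of t] by (simp_all add: G_def)

lemma tails_Suc: "tails (Suc t) = T (Suc t) # tails t"
  by (simp add: tails_def upt_Suc)

lemma tails_le: "x \<in> set (tails t) \<Longrightarrow> x \<le> T t"
  using monoD[OF strict_mono_mono[OF T_mono]] by (auto simp: tails_def)

lemma valid_sorted:
  assumes "sorted_wrt (\<ge>) M" "\<And>x. x \<in> set M \<Longrightarrow> T t \<le> x \<and> x \<le> H"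
  shows "valid_items (replicate h H @ M @ tails t)" "sorted_wrt (\<ge>) (replicate h H @ M @ tails t)"
proof -
  have ts: "0 < x \<and> x \<le> H" if x: "x \<in> set (tails t)" for x
  proof -
    obtain i where "x = T i" using x by (auto simp: tails_def)
    then show ?thesis using T_ge[of i] T_le[of i] by (simp add: H_def)
  qed
  then show "valid_items (replicate h H @ M @ tails t)"
    using assms(2) T_ge[of t] by (force simp: valid_items_def H_def)
  have "sorted_wrt (\<lambda>i j. T i \<le> T j) [1..<Suc t]"
    using strict_mono_mono[OF T_mono]
    by (intro sorted_wrt_mono_rel[OF _ sorted_wrt_upt]) (auto simp: mono_def)
  then have "sorted_wrt (\<ge>) (tails t)"
    unfolding tails_def sorted_wrt_rev sorted_wrt_map .
  moreover have "sorted_wrt (\<ge>) (replicate h H)"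
    by (induction h) auto
  ultimately show "sorted_wrt (\<ge>) (replicate h H @ M @ tails t)"
    using assms ts tails_le by (fastforce simp: sorted_wrt_append)
qed

lemma sorted_replicate: "sorted_wrt (\<ge>) (replicate a (x :: real))"
  by (induction a) auto

lemma valid_sorted_instB: "valid_items (instB h t)" "sorted_wrt (\<ge>) (instB h t)"
  using valid_sorted[of "replicate (h + 2 * t) (G t)" t h] G_bounds[of t] T_le[of t]
  by (auto simp: instB_def H_def sorted_replicate)

lemma valid_sorted_instA: "valid_items (instA t)" "sorted_wrt (\<ge>) (instA t)"
proof -
  have G_less: "G (Suc t) < G t" using T_less by (simp add: G_def)
  have "sorted_wrt (\<ge>) (endgame t)"
    using G_bounds[of t] G_bounds[of "Suc t"] G_less T_le[of "Suc t"]
    by (auto simp: endgame_def sorted_wrt_append sorted_replicate)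
  moreover have "T t \<le> x \<and> x \<le> H" if "x \<in> set (endgame t)" for x
    using that G_bounds[of t] G_bounds[of "Suc t"] T_le[of t] T_le[of "Suc t"] T_less[of t]
    by (auto simp: endgame_def H_def)
  ultimately show "valid_items (instA t)" "sorted_wrt (\<ge>) (instA t)"
    unfolding instA_def by (rule valid_sorted; blast)+
qed

section \<open>Optimal packings of the instances\<close>

definition binsB :: "nat \<Rightarrow> nat \<Rightarrow> real list list" where
  "binsB h t = replicate h [H, G t] @ map (\<lambda>i. [T i, G t, G t]) [1..<Suc t]"

lemma mset_binsB:
  "mset (concat (binsB h t)) = replicate_mset h H + replicate_mset (h + 2 * t) (G t) + mset (tails t)"
  by (simp add: binsB_def mset_concat_replicate_pair mset_concat_map_triple tails_def
      replicate_mset_plus del: mset_concat)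

lemma binsB_sum:
  assumes "b \<in> set (binsB h t)"
  shows "sum_list b \<le> 1" "1 - 1 / (100 * real (2 * n + 2)) \<le> sum_list b"
proof -
  define d where "d = 1 / (100 * real (2 * n + 2))"
  have d: "0 \<le> d" "T t < 3 / 10 + d" using T_lt[of t] by (simp_all add: d_def)
  consider "b = [H, G t]" | i where "i \<le> t" "b = [T i, G t, G t]"
    using assms by (auto simp: binsB_def less_Suc_eq_le)
  then have "sum_list b \<le> 1 \<and> 1 - d \<le> sum_list b"
  proof cases
    case 1
    then show ?thesis using d T_ge[of t] by (simp add: H_def G_def field_simps)
  next
    case (2 i)
    have "T i \<le> T t" using monoD[OF strict_mono_mono[OF T_mono] 2(1)] .
    then show ?thesis using d T_ge[of i] 2(2) by (simp add: G_def)
  qed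
  then show "sum_list b \<le> 1" "1 - 1 / (100 * real (2 * n + 2)) \<le> sum_list b"
    by (simp_all only: d_def)
qed

lemma length_binsB: "length (binsB h t) = h + t"
  by (simp add: binsB_def)

text \<open>The spread of the tails bounds the waste of a single bin; it is chosen so small that
  \<open>2 * n + 2\<close> bins together waste at most \<open>1 / 100\<close>.\<close>

lemma binsB_volume:
  assumes "h + t \<le> 2 * n + 2"
  shows "real (h + t) - 1 / 100 \<le> sum_list (concat (binsB h t))"
proof -
  have "real (h + t) * (1 / (100 * real (2 * n + 2))) \<le> real (2 * n + 2) * (1 / (100 * real (2 * n + 2)))"
    using assms by (intro mult_right_mono) auto
  also have "\<dots> = 1 / 100" by simp
  finally have "real (h + t) - 1 / 100 \<le> real (h + t) * (1 - 1 / (100 * real (2 * n + 2)))"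
    by (simp add: right_diff_distrib)
  also have "\<dots> \<le> sum_list (concat (binsB h t))"
    using sum_list_concat_ge[of "binsB h t", OF binsB_sum(2)] by (simp only: length_binsB)
  finally show ?thesis .
qed

lemma sum_list_eqI: "mset xs = mset ys \<Longrightarrow> sum_list xs = sum_list (ys :: real list)"
  by (metis sum_mset_sum_list)

lemma opt_instB:
  assumes "h + t = 2 * n + 2"
  shows "opt (instB h t) = 2 * n + 2"
proof -
  have eq: "mset (instB h t) = mset (concat (binsB h t))"
    by (simp add: instB_def mset_binsB del: mset_concat)
  then have "opt (instB h t) = length (binsB h t)"
    using binsB_volume[of h t] assms
    by (intro opt_eqI) (auto simp: binsB_sum(1) length_binsB sum_list_eqI[OF eq])
  then show ?thesis using assms by (simp add: length_binsB)
qed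

lemma opt_instA:
  assumes "t \<le> n" "n \<le> Suc t"
  shows "opt (instA t) = 2 * n + 2"
proof -
  \<comment> \<open>If \<open>t = n - 1\<close>, one tail is missing and its two partners form a bin
    of their own; the space wasted there is still less than a bin.\<close>
  define bs where "bs = binsB n t @ replicate (n - t) [G t, G t] @
    [[36 / 100, 32 / 100, 32 / 100], [T (Suc t), G (Suc t), G (Suc t)]]"
  have "3 * n = n + 2 * t + (n - t) + (n - t)" using assms by simp
  then have rep: "replicate_mset (3 * n) (G t) =
      replicate_mset (n + 2 * t) (G t) + replicate_mset (n - t) (G t) + replicate_mset (n - t) (G t)"
    by (metis replicate_mset_plus)
  have eq: "mset (instA t) = mset (concat bs)"
    unfolding bs_def concat_append mset_append mset_binsB mset_concat_replicate_pair instA_def endgame_def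
    by (simp add: rep)
  have len: "length bs = 2 * n + 2" using assms by (simp add: bs_def length_binsB)
  have "sum_list (concat (replicate (n - t) [G t, G t])) \<ge> real (n - t) * (69 / 100)"
    using sum_list_concat_ge[of "replicate (n - t) [G t, G t]" "69 / 100"] G_bounds[of t] by simp
  moreover have "real (n - t) \<le> 1" "real (n - t) = real n - real t" using assms by auto
  ultimately have "real (length bs) - 1 < sum_list (concat bs)"
    using binsB_volume[of n t] assms unfolding len by (simp add: bs_def G_def)
  moreover have "\<forall>b\<in>set bs. sum_list b \<le> 1"
    using binsB_sum(1) G_bounds[of t] by (auto simp: bs_def G_def)
  ultimately show ?thesis
    using opt_eqI[OF eq] len sum_list_eqI[OF eq] by simp
qed

section \<open>The game\<close>

text \<open>\<open>M\<close> is the part not yet packed. One history serves many \<open>M\<close>,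
  so the adversary may settle the instance later.\<close>

definition follows :: "nat \<Rightarrow> nat \<Rightarrow> history \<Rightarrow> real \<Rightarrow> nat \<Rightarrow> real list \<Rightarrow> bool" where
  "follows i j h load k M \<longleftrightarrow> run A [] (replicate i H @ M @ tails j) 0 0 = run A h M load k"

lemma follows_head:
  assumes "follows i j h load k (H # M)" "last (H # M) = y" "fst (A h H y)"
    and "nb \<longleftrightarrow> snd (A h H y) \<or> k = 0 \<or> 1 < load + H"
  shows "follows (Suc i) j (h @ [(H, True, nb)]) (if nb then H else load + H) (if nb then Suc k else k) M"
  using assms run_head[of "H # M" A h nb k load]
  by (simp add: follows_def replicate_app_Cons_same)

lemma follows_tail:
  assumes "follows i j h load k (M @ [T (Suc j)])" "hd (M @ [T (Suc j)]) = x"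
    and "\<not> fst (A h x (T (Suc j)))"
    and "nb \<longleftrightarrow> snd (A h x (T (Suc j))) \<or> k = 0 \<or> 1 < load + T (Suc j)"
  shows "follows i (Suc j) (h @ [(T (Suc j), False, nb)])
           (if nb then T (Suc j) else load + T (Suc j)) (if nb then Suc k else k) M"
  using assms run_tail[of "M @ [T (Suc j)]" A h nb k load]
  by (simp add: follows_def tails_Suc)

text \<open>After taking a head the old tail is still visible, whereas the next head is free to be
  chosen; symmetrically after taking a tail.\<close>

definition after_head :: "nat \<Rightarrow> nat \<Rightarrow> history \<Rightarrow> real \<Rightarrow> nat \<Rightarrow> bool" where
  "after_head i j h load k \<longleftrightarrow> (\<forall>M. M \<noteq> [] \<longrightarrow> last M = T (Suc j) \<longrightarrow> follows i j h load k M)"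

definition after_tail :: "nat \<Rightarrow> nat \<Rightarrow> history \<Rightarrow> real \<Rightarrow> nat \<Rightarrow> bool" where
  "after_tail i j h load k \<longleftrightarrow> (\<forall>M. M \<noteq> [] \<longrightarrow> hd M = H \<longrightarrow> follows i j h load k M)"

definition reach :: "nat \<Rightarrow> nat \<Rightarrow> history \<Rightarrow> real \<Rightarrow> nat \<Rightarrow> bool" where
  "reach i j h load k \<longleftrightarrow> after_head i j h load k \<or> after_tail i j h load k"

definition placed :: "real \<Rightarrow> nat \<Rightarrow> real \<Rightarrow> real \<Rightarrow> nat \<Rightarrow> bool" where
  "placed load k y load' k' \<longleftrightarrow>
     load' = y \<and> k' = Suc k \<or> load' = load + y \<and> k' = k \<and> 0 < k \<and> load' \<le> 1"

text \<open>In either state the free end can be set so that the algorithm sees \<open>H\<close> and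
  \<open>T (Suc j)\<close>; its decision is then the same for all such continuations.\<close>

lemma move:
  assumes "reach i j h load k"
  obtains (head) h' load' k' where "after_head (Suc i) j h' load' k'" "placed load k H load' k'"
  | (tail) h' load' k' where "after_tail i (Suc j) h' load' k'" "placed load k (T (Suc j)) load' k'"
proof (cases "fst (A h H (T (Suc j)))")
  case True
  define nb where "nb \<longleftrightarrow> snd (A h H (T (Suc j))) \<or> k = 0 \<or> 1 < load + H"
  have "after_head (Suc i) j (h @ [(H, True, nb)]) (if nb then H else load + H) (if nb then Suc k else k)"
    unfolding after_head_def
  proof (intro allI impI)
    fix M assume "M \<noteq> []" "last M = T (Suc j)"
    then show "follows (Suc i) j (h @ [(H, True, nb)]) (if nb then H else load + H) (if nb then Suc k else k) M"
      using assms True nb_def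
      by (intro follows_head) (auto simp: reach_def after_head_def after_tail_def)
  qed
  then show thesis by (rule head) (auto simp: placed_def nb_def)
next
  case False
  define nb where "nb \<longleftrightarrow> snd (A h H (T (Suc j))) \<or> k = 0 \<or> 1 < load + T (Suc j)"
  have "after_tail i (Suc j) (h @ [(T (Suc j), False, nb)])
      (if nb then T (Suc j) else load + T (Suc j)) (if nb then Suc k else k)"
    unfolding after_tail_def
  proof (intro allI impI)
    fix M assume "M \<noteq> []" "hd M = H"
    then show "follows i (Suc j) (h @ [(T (Suc j), False, nb)])
        (if nb then T (Suc j) else load + T (Suc j)) (if nb then Suc k else k) M"
      using assms False nb_def
      by (intro follows_tail) (auto simp: reach_def after_head_def after_tail_def)
  qed
  then show thesis by (rule tail) (auto simp: placed_def nb_def)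
qed

text \<open>Heads weigh \<open>3/4\<close>, tails \<open>1/4\<close> and the items \<open>G\<close> to come \<open>1/2\<close>, which adds up to \<open>5/4\<close> per
  optimal bin. \<open>slack\<close> is four times the weight by which the \<open>k\<close> bins have to exceed their
  contents; it covers the items \<open>G\<close> that the open bin can still receive.\<close>

definition slack :: "real \<Rightarrow> nat" where
  "slack load = (if load < 6 / 10 then 4 else if load < 9 / 10 then 2 else 1)"

definition good :: "nat \<Rightarrow> nat \<Rightarrow> real \<Rightarrow> nat \<Rightarrow> bool" where
  "good i j load k \<longleftrightarrow> 3 / 10 \<le> load \<and> 3 * i + j + slack load \<le> 4 * k"

text \<open>A new bin adds \<open>4\<close>, while \<open>H\<close> and the new slack take
  \<open>3 + 2\<close>; the old slack, at least \<open>1\<close>, pays the difference. If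
  \<open>H\<close> joins, the slack drops from \<open>4\<close> to \<open>1\<close>.\<close>

lemma good_head: "good i j load k \<Longrightarrow> placed load k H load' k' \<Longrightarrow> good (Suc i) j load' k'"
  by (auto simp: good_def placed_def slack_def H_def split: if_splits)

lemma good_tail:
  "good i j load k \<Longrightarrow> placed load k (T (Suc j)) load' k' \<Longrightarrow> good i (Suc j) load' k'"
  using T_ge[of "Suc j"] T_le[of "Suc j"]
  by (auto simp: good_def placed_def slack_def split: if_splits)

text \<open>\<open>W\<close> covers both completions: the items \<open>G\<close> alone, or the items
  \<open>G\<close> with one last \<open>H\<close>. Either way there are \<open>i + 2 * j + 2\<close>
  items.\<close>

lemma wins_instB:
  assumes "follows i j h load k M" "good i j load k" "i + j = 2 * n + 1"
    and I: "replicate i H @ M @ tails j = instB h' t" "h' + t = 2 * n + 2"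
    and W: "W \<subseteq># mset M" "size W = i + 2 * j + 2" "\<And>x. x \<in># W \<Longrightarrow> 345 / 1000 \<le> x"
    and pos: "\<forall>x\<in>set M. 0 \<le> x"
  shows "wins (instB h' t)"
proof -
  \<comment> \<open>At most \<open>c\<close> counted items still fit into the open bin;
    \<open>slack load\<close> is at least \<open>2 * c\<close> and pays for the halves lost to
    them.\<close>
  define c :: nat where "c = (if load < 6 / 10 then 2 else if load < 9 / 10 then 1 else 0)"
  have "at_most c load W" "at_most 2 0 W"
    using assms(2) W(3) by (auto intro!: at_most_ge[where g = "345 / 1000"] simp: c_def good_def)
  then have "lb M load (size W - c)"
    using W(1) pos by (intro lb_weight) (auto simp: c_def)
  moreover have "0 < k" "3 * i + j + 2 * c \<le> 4 * k"
    using assms(2) by (auto simp: good_def slack_def c_def split: if_splits)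
  moreover have "alg_bins A (instB h' t) = run A h M load k"
    using assms(1) I(1) by (simp add: alg_bins_def follows_def)
  ultimately have "5 * (2 * n + 2) \<le> 4 * alg_bins A (instB h' t) + 1"
    using lbD[of M load "size W - c" k A h] assms(3) W(2) by (simp add: c_def split: if_splits)
  then show ?thesis
    using valid_sorted_instB opt_instB[OF I(2)] by (simp add: wins_def)
qed

text \<open>The item still visible must occur in the instance: after a head the next tail, after a
  tail the head \<open>H\<close>. This determines the completion.\<close>

lemma wins_of_good_last:
  assumes "reach i j h load k" "good i j load k" "i + j = 2 * n + 1"
  shows "\<exists>I. wins I"
  using assms(1) unfolding reach_def
proof
  assume *: "after_head i j h load k"
  let ?M = "replicate (i + 2 * Suc j) (G (Suc j)) @ [T (Suc j)]"
  have "wins (instB i (Suc j))"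
  proof (rule wins_instB)
    show "follows i j h load k ?M" using * by (simp add: after_head_def)
    show "replicate i H @ ?M @ tails j = instB i (Suc j)"
      by (simp add: instB_def tails_Suc)
    show "replicate_mset (i + 2 * Suc j) (G (Suc j)) \<subseteq># mset ?M" by simp
    show "\<forall>x\<in>set ?M. 0 \<le> x"
      using G_bounds[of "Suc j"] T_ge[of "Suc j"] by auto
    show "345 / 1000 \<le> x" if "x \<in># replicate_mset (i + 2 * Suc j) (G (Suc j))" for x
      using that G_bounds(1)[of "Suc j"] by (auto split: if_splits)
  qed (use assms in auto)
  then show ?thesis by blast
next
  assume *: "after_tail i j h load k"
  let ?M = "H # replicate (Suc i + 2 * j) (G j)"
  have "wins (instB (Suc i) j)"
  proof (rule wins_instB)
    show "follows i j h load k ?M" using * by (simp add: after_tail_def)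
    show "replicate i H @ ?M @ tails j = instB (Suc i) j"
      by (simp add: instB_def replicate_app_Cons_same)
    show "mset ?M \<subseteq># mset ?M" by simp
    show "\<forall>x\<in>set ?M. 0 \<le> x"
      using G_bounds[of j] by (auto simp: H_def)
    show "345 / 1000 \<le> x" if "x \<in># mset ?M" for x
      using that G_bounds(1)[of j] by (auto simp: H_def split: if_splits)
  qed (use assms in auto)
  then show ?thesis by blast
qed

lemma wins_of_good:
  assumes "reach i j h load k" "good i j load k" "i + j \<le> 2 * n + 1"
  shows "\<exists>I. wins I"
  using assms
proof (induction "2 * n + 1 - (i + j)" arbitrary: i j h load k)
  case 0
  then show ?case by (intro wins_of_good_last) auto
next
  case (Suc d)
  show ?case using Suc.prems(1)
  proof (cases rule: move)
    case (head h' load' k')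
    then show ?thesis
      using Suc good_head by (intro Suc.hyps(1)[of "Suc i" j h' load' k']) (auto simp: reach_def)
  next
    case (tail h' load' k')
    then show ?thesis
      using Suc good_tail by (intro Suc.hyps(1)[of i "Suc j" h' load' k']) (auto simp: reach_def)
  qed
qed

lemma wins_instA:
  assumes "t \<le> n" "n \<le> Suc t"
    and run: "run A [] (instA t) 0 0 = run A h (endgame t) load n"
    and new: "snd (A h (36 / 100) (T (Suc t))) \<or> n = 0 \<or>
      load + (if fst (A h (36 / 100) (T (Suc t))) then 36 / 100 else T (Suc t)) > 1"
  shows "wins (instA t)"
proof -
  \<comment> \<open>The left side is \<open>5 * n + 5\<close> halves, which is \<open>5 / 4\<close>
    of \<open>2 * n + 2\<close> bins.\<close>
  have "2 * n + length (replicate (3 * n) (G t)) + 5 \<le> 2 * run A h (endgame t) load n"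
  proof (rule endgame_run)
    show "G (Suc t) = (1 - T (Suc t)) / 2" by (simp add: G_def)
    show "\<forall>x\<in>set (36 / 100 # replicate (3 * n) (G t)). G (Suc t) < x \<and> x \<le> 1"
      using T_less[of t] G_bounds[of t] G_bounds[of "Suc t"] by (auto simp: G_def)
    show "endgame t = 36 / 100 # replicate (3 * n) (G t) @
        [G (Suc t), G (Suc t), 32 / 100, 32 / 100, T (Suc t)]"
      by (rule endgame_def)
  qed (use new T_ge[of "Suc t"] T_le[of "Suc t"] in auto)
  then have "5 * (2 * n + 2) \<le> 4 * alg_bins A (instA t) + 1"
    using run by (simp add: alg_bins_def)
  then show ?thesis
    using valid_sorted_instA opt_instA assms(1,2) by (simp add: wins_def)
qed

text \<open>The only plays that never become good pack every pair \<open>H, T i\<close> into a bin of its own.\<close>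

definition tight :: "nat \<Rightarrow> history \<Rightarrow> real \<Rightarrow> bool" where
  "tight j h load \<longleftrightarrow> reach j j h load j \<and> (j = 0 \<or> 9 / 10 \<le> load)"

lemma tight_placed:
  assumes "tight j h load" "placed load j y load' k'" "3 / 10 \<le> y"
  shows "load' = y" "k' = Suc j"
  using assms by (auto simp: tight_def placed_def)

text \<open>Any two moves other than \<open>H\<close> and \<open>T\<close> sharing a bin leave
  enough bins for \<open>good\<close>. A shared bin weighs exactly \<open>4\<close> and so misses
  the slack by one.\<close>

lemma wins_or_tight:
  assumes "tight j h load" "j < n"
  shows "(\<exists>I. wins I) \<or> (\<exists>h' load'. tight (Suc j) h' load')"
proof -
  note T1 = T_ge[of "Suc j"] T_le[of "Suc j"] and T2 = T_ge[of "Suc (Suc j)"] T_le[of "Suc (Suc j)"]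
  have "reach j j h load j" using assms(1) by (simp add: tight_def)
  then show ?thesis
  proof (cases rule: move)
    case (head h1 l1 k1)
    then have k1: "k1 = Suc j" and l1: "l1 = H"
      using tight_placed[OF assms(1) head(2)] by (simp_all add: H_def)
    have "reach (Suc j) j h1 l1 k1" using head(1) by (simp add: reach_def)
    then show ?thesis
    proof (cases rule: move)
      case (head h2 l2 k2)
      then have "good (Suc (Suc j)) j l2 k2"
        by (auto simp: k1 l1 placed_def good_def slack_def H_def)
      then show ?thesis using wins_of_good[of "Suc (Suc j)" j] head(1) assms(2) by (auto simp: reach_def)
    next
      case (tail h2 l2 k2)
      then consider "good (Suc j) (Suc j) l2 k2" | "9 / 10 \<le> l2" "k2 = Suc j"
        using T1 by (auto simp: k1 l1 placed_def good_def slack_def H_def)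
      then show ?thesis
      proof cases
        case 1
        then show ?thesis using wins_of_good[of "Suc j" "Suc j"] tail(1) assms(2) by (auto simp: reach_def)
      next
        case 2
        then show ?thesis using tail(1) by (auto simp: tight_def reach_def)
      qed
    qed
  next
    case (tail h1 l1 k1)
    then have k1: "k1 = Suc j" and l1: "l1 = T (Suc j)"
      using tight_placed[OF assms(1)] T1 by auto
    have "reach j (Suc j) h1 l1 k1" using tail(1) by (simp add: reach_def)
    then show ?thesis
    proof (cases rule: move)
      case (head h2 l2 k2)
      then consider "good (Suc j) (Suc j) l2 k2" | "9 / 10 \<le> l2" "k2 = Suc j"
        using T1 by (auto simp: k1 l1 placed_def good_def slack_def H_def)
      then show ?thesis
      proof cases
        case 1
        then show ?thesis using wins_of_good[of "Suc j" "Suc j"] head(1) assms(2) by (auto simp: reach_def)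
      next
        case 2
        then show ?thesis using head(1) by (auto simp: tight_def reach_def)
      qed
    next
      case (tail h2 l2 k2)
      then have "good j (Suc (Suc j)) l2 k2"
        using T1 T2 by (auto simp: k1 l1 placed_def good_def slack_def)
      then show ?thesis using wins_of_good[of j "Suc (Suc j)"] tail(1) assms(2) by (auto simp: reach_def)
    qed
  qed
qed

lemma endgame_simps: "endgame t \<noteq> []" "hd (endgame t) = 36 / 100" "last (endgame t) = T (Suc t)"
  by (simp_all add: endgame_def)

lemma wins_of_tight_last:
  assumes "tight j h load" "n = Suc j"
  shows "\<exists>I. wins I"
proof -
  note T1 = T_ge[of n] T_le[of n] and T2 = T_ge[of "Suc n"] T_le[of "Suc n"]
  have "reach j j h load j" using assms(1) by (simp add: tight_def)
  then show ?thesis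
  proof (cases rule: move)
    case (head h1 l1 k1)
    then have k1: "k1 = n" and l1: "l1 = H"
      using tight_placed[OF assms(1) head(2)] assms(2) by (simp_all add: H_def)
    \<comment> \<open>With \<open>H\<close> alone in the open bin, the adversary shows
      \<open>36 / 100\<close> instead of another \<open>H\<close>, while \<open>T n\<close> stays
      visible.\<close>
    let ?d = "A h1 (36 / 100) (T n)"
    have fol: "follows n j h1 H n M" if "M \<noteq> []" "last M = T n" for M
      using head(1) that by (simp add: after_head_def k1 l1 assms(2))
    show ?thesis
    proof (cases "fst ?d \<or> snd ?d")
      case True
      have T_eq: "T n = T (Suc j)" using assms(2) by simp
      have "wins (instA j)"
      proof (rule wins_instA)
        show "run A [] (instA j) 0 0 = run A h1 (endgame j) H n"
          using fol[of "endgame j"] T_eq by (simp add: follows_def instA_def endgame_simps)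
        show "snd (A h1 (36 / 100) (T (Suc j))) \<or> n = 0 \<or>
            1 < H + (if fst (A h1 (36 / 100) (T (Suc j))) then 36 / 100 else T (Suc j))"
          using True assms(2) by (auto simp: H_def)
      qed (use assms in auto)
      then show ?thesis by blast
    next
      case False
      \<comment> \<open>Now \<open>T n\<close> joins \<open>H\<close>. As \<open>endgame n\<close>
        also begins with \<open>36 / 100\<close>, the adversary can still switch to it, and neither
        of its ends fits into this bin.\<close>
      have hd_eq: "hd (endgame n @ [T (Suc j)]) = 36 / 100" by (simp add: endgame_simps)
      have "follows n j h1 H n (endgame n @ [T (Suc j)])" using fol assms(2) by simp
      then have "follows n (Suc j) (h1 @ [(T (Suc j), False, False)]) (H + T (Suc j)) n (endgame n)"
        using follows_tail[of n j h1 H n "endgame n" "36 / 100" False] hd_eq False assms(2) T1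
        by (simp add: H_def)
      then have "follows n n (h1 @ [(T n, False, False)]) (H + T n) n (endgame n)"
        using assms(2) by simp
      then have "wins (instA n)"
        using T1 T2
        by (intro wins_instA[where h = "h1 @ [(T n, False, False)]" and load = "H + T n"])
          (auto simp: follows_def instA_def H_def)
      then show ?thesis by blast
    qed
  next
    case (tail h1 l1 k1)
    then have k1: "k1 = n" and l1: "l1 = T n"
      using tight_placed[OF assms(1)] T1 assms(2) by auto
    have "reach j n h1 l1 k1" using tail(1) assms(2) by (simp add: reach_def)
    then show ?thesis
    proof (cases rule: move)
      case (head h2 l2 k2)
      then consider "good n n l2 k2" | "9 / 10 \<le> l2" "k2 = n"
        using T1 assms(2) by (auto simp: k1 l1 placed_def good_def slack_def H_def)
      then show ?thesis
      proof cases
        case 1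
        then show ?thesis using wins_of_good[of n n] head(1) assms(2) by (auto simp: reach_def)
      next
        case 2
        have "after_head n n h2 l2 n" using head(1) 2 assms(2) by simp
        then have "follows n n h2 l2 n (endgame n)"
          by (simp add: after_head_def endgame_simps)
        then have "wins (instA n)"
          using T2 2 by (intro wins_instA) (auto simp: follows_def instA_def)
        then show ?thesis by blast
      qed
    next
      case (tail h2 l2 k2)
      then have "good j (Suc n) l2 k2"
        using T1 T2 assms(2) by (auto simp: k1 l1 placed_def good_def slack_def)
      then show ?thesis using wins_of_good[of j "Suc n"] tail(1) assms(2) by (auto simp: reach_def)
    qed
  qed
qed

lemma ex_wins: "\<exists>I. wins I"
proof (cases n)
  case 0
  \<comment> \<open>Without heads the endgame is the whole instance, and its first packed item has
    to open a bin.\<close>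
  have "instA 0 = endgame 0" unfolding instA_def by (simp add: 0 tails_def)
  then have "wins (instA 0)"
    by (intro wins_instA[where h = "[]" and load = 0]) (simp_all add: 0)
  then show ?thesis by blast
next
  case (Suc j)
  have "tight 0 [] 0"
    by (simp add: tight_def reach_def after_head_def follows_def tails_def)
  then have "i < n \<Longrightarrow> (\<exists>I. wins I) \<or> (\<exists>h load. tight i h load)" for i
    by (induction i) (use wins_or_tight Suc_lessD in blast)+
  then show ?thesis using wins_of_tight_last Suc by blast
qed

end

theorem theorem2:
  fixes A :: maxmin_alg and m :: nat
  assumes "m > 0" and "even m"
  shows "\<exists>I. valid_items I \<and> sorted_wrt (\<ge>) I \<and> opt I = m \<and>
             real (alg_bins A I) \<ge> 5/4 * real (opt I) - 1/4"
proof -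
  obtain n where m: "m = 2 * n + 2"
    using assms by (metis add.commute dvd_def gr0_implies_Suc mult_0_right mult_Suc_right not_gr_zero)
  define d where "d = 1 / (100 * real (2 * n + 2))"
  have d: "0 < d" by (simp add: d_def)
  \<comment> \<open>An increasing sequence in \<open>[0, 1)\<close>, to be scaled to the admissible
    range of the tails.\<close>
  define q where "q j = real j / real (Suc j)" for j
  have q: "0 \<le> q j" "q j < 1" "q j < q (Suc j)" for j
    by (simp_all add: q_def field_simps)
  interpret maxmin_adversary A n "\<lambda>j. 3 / 10 + d * q j"
  proof
    show "3 / 10 \<le> 3 / 10 + d * q j" for j using d q(1) by simp
    show "3 / 10 + d * q j < 3 / 10 + 1 / (100 * real (2 * n + 2))" for j
      unfolding d_def[symmetric] using d q(2)[of j] by simp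
    show "strict_mono (\<lambda>j. 3 / 10 + d * q j)"
      using d q(3) by (simp add: strict_mono_Suc_iff)
  qed
  obtain I where "wins I" using ex_wins by blast
  then have "valid_items I" "sorted_wrt (\<ge>) I" "opt I = m" "5 * m \<le> 4 * alg_bins A I + 1"
    by (auto simp: wins_def m)
  moreover from this have "real (5 * m) \<le> real (4 * alg_bins A I + 1)" by linarith
  ultimately show ?thesis by (intro exI[of _ I]) auto
qed

end
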